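(* For every positive integer $h$, the distance spectral radius of the multiplicative circulant graph $MC(3^h)$ is $\rho(MC(3^h))=2h\cdot 3^{h-1}$.
   Context: For integers $m>1$, $h>0$, $MC(m^h)$ is the graph with vertex set $\mathbb{Z}_{m^h}$ in which distinct vertices $x,y$ are adjacent iff $x-y\equiv \pm m^i \pmod{m^h}$ for some $i\in\{0,\ldots,h-1\}$. The distance spectral radius of a graph is the largest eigenvalue of its distance matrix $[d(v_i,v_j)]$ of shortest-path distances. *)

theory Defs
  imports
    "HOL-Number_Theory.Cong"
    "Graph_Theory.Pair_Digraph"
    "Graph_Theory.Shortest_Path"
    "Jordan_Normal_Form.Spectral_Radius"
begin

text \<open>The residues modulo \<open>m ^ h\<close> are represented by \<open>0, \<dots>, m ^ h - 1\<close>; an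
  undirected edge is a pair of opposite arcs.\<close>

definition MC :: "int \<Rightarrow> nat \<Rightarrow> int pair_pre_digraph" where
  "MC m h = \<lparr> pverts = {0..<m ^ h},
     parcs = {(x, y). x \<in> {0..<m ^ h} \<and> y \<in> {0..<m ^ h} \<and> x \<noteq> y \<and>
       (\<exists>i\<in>{0..<h}. [x - y = m ^ i] (mod m ^ h) \<or> [x - y = - (m ^ i)] (mod m ^ h))} \<rparr>"

text \<open>\<open>wf_digraph.\<mu>\<close> with unit weights is the length of a shortest walk; it is
  \<open>\<infinity>\<close> exactly when there is none, so the conversion to \<open>real\<close> is only
  meaningful for connected graphs.\<close>

definition graph_dist :: "'a pair_pre_digraph \<Rightarrow> 'a \<Rightarrow> 'a \<Rightarrow> real" where
  "graph_dist G u v = real_of_ereal (wf_digraph.\<mu> (with_proj G) (\<lambda>_. 1) u v)"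

definition distance_matrix :: "'a :: linorder pair_pre_digraph \<Rightarrow> real mat" where
  "distance_matrix G =
     (let vs = sorted_list_of_set (pverts G); n = card (pverts G)
      in mat n n (\<lambda>(i, j). graph_dist G (vs ! i) (vs ! j)))"

text \<open>The distance matrix of an undirected graph is real symmetric, so its real eigenvalues
  are all its eigenvalues.\<close>

definition distance_spectral_radius :: "'a :: linorder pair_pre_digraph \<Rightarrow> real" where
  "distance_spectral_radius G = Max (spectrum (distance_matrix G))"

end

theory Submission
  imports Defs
begin

text \<open>Every residue modulo \<open>3 ^ h\<close> has a unique balanced ternary expansion with \<open>h\<close> digits in
  \<open>{-1, 0, 1}\<close>. Adding \<open>\<plusminus> 3 ^ i\<close> changes the number of nonzero digits by at most one, since a
  carry out of a digit leaves that digit nonzero, so the distance between \<open>u\<close> and \<open>v\<close> is the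
  number of nonzero digits of \<open>v - u\<close>. Hence all rows of the distance matrix sum to
  \<open>(2 / 3) * h * 3 ^ h\<close>, and a nonnegative matrix with constant row sums has that
  sum as its largest eigenvalue.\<close>

section \<open>Balanced ternary weight modulo \<open>3 ^ h\<close>\<close>

text \<open>The last balanced ternary digit of \<open>x\<close> is \<open>x - 3 * ((x + 1) div 3)\<close>.\<close>

primrec balanced_weight :: "nat \<Rightarrow> int \<Rightarrow> nat" where
  "balanced_weight 0 x = 0"
| "balanced_weight (Suc h) x = (if 3 dvd x then 0 else 1) + balanced_weight h ((x + 1) div 3)"

lemma balanced_weight_zero [simp]: "balanced_weight h 0 = 0"
  by (induction h) auto

text \<open>Only the lowest \<open>h\<close> digits are counted, and a multiple of
  \<open>3 ^ h\<close> leaves them alone; so the weight is a function of residues.\<close>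

lemma balanced_weight_add_period: "balanced_weight h (x + 3 ^ h * k) = balanced_weight h x"
proof (induction h arbitrary: x)
  case (Suc h)
  have "(x + 3 ^ Suc h * k + 1) div 3 = (x + 1) div 3 + 3 ^ h * k"
    by (simp add: algebra_simps)
  moreover have "3 dvd x + 3 ^ Suc h * k \<longleftrightarrow> 3 dvd x"
    by (simp add: dvd_add_left_iff)
  ultimately show ?case
    using Suc.IH by simp
qed simp

lemma balanced_weight_cong:
  assumes "[x = y] (mod 3 ^ h)"
  shows "balanced_weight h x = balanced_weight h y"
  using assms by (auto simp: cong_iff_lin balanced_weight_add_period)

lemma balanced_weight_eq_0D: "balanced_weight h x = 0 \<Longrightarrow> 3 ^ h dvd x"
proof (induction h arbitrary: x)
  case (Suc h)
  then have "3 dvd x" and "3 ^ h dvd (x + 1) div 3"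
    by (auto split: if_splits)
  moreover from \<open>3 dvd x\<close> have "x = 3 * ((x + 1) div 3)"
    by presburger
  ultimately show ?case
    by (metis mult_dvd_mono dvd_refl power_Suc)
qed simp

lemma balanced_weight_add_power_le:
  assumes "s = 1 \<or> s = -1"
  shows "balanced_weight h (x + s * 3 ^ i) \<le> Suc (balanced_weight h x)"
proof (induction h arbitrary: x i)
  case (Suc h)
  show ?case
  proof (cases i)
    case 0
    have "\<exists>k. x = 3 * k \<or> x = 3 * k + 1 \<or> x = 3 * k - 1"
      by presburger
    then obtain k where "x = 3 * k \<or> x = 3 * k + 1 \<or> x = 3 * k - 1" ..
    \<comment> \<open>Measuring the last digit relative to \<open>s\<close> treats both signs at
      once; only the digit \<open>s\<close> causes a carry.\<close>
    then consider "x = 3 * k" | "x = 3 * k + s" | "x = 3 * k - s"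
      using assms by fastforce
    then show ?thesis
    proof cases
      case 1
      then have "(x + 1) div 3 = k" "(x + s + 1) div 3 = k"
        using assms by auto
      then show ?thesis
        using 0 1 by simp
    next
      case 2
      \<comment> \<open>Since \<open>s + s = 3 * s - s\<close>, the digit becomes \<open>-s\<close>
        and \<open>s\<close> is carried into the quotient, hence the induction hypothesis at
        exponent 0.\<close>
      then have "(x + 1) div 3 = k" "(x + s + 1) div 3 = k + s" "\<not> 3 dvd x"
        using assms by (elim disjE; hypsubst; presburger)+
      then show ?thesis
        using 0 Suc.IH[of k 0] by simp
    next
      case 3
      then have "(x + 1) div 3 = k" "(x + s + 1) div 3 = k" "3 dvd x + s"
        using assms by auto
      then show ?thesis
        using 0 by simp
    qed
  next
    case (Suc j)
    have "(x + s * 3 ^ i + 1) div 3 = (x + 1) div 3 + s * 3 ^ j"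
      using Suc by (simp add: algebra_simps)
    moreover have "3 dvd x + s * 3 ^ i \<longleftrightarrow> 3 dvd x"
      using Suc by (simp add: dvd_add_left_iff)
    ultimately show ?thesis
      using Suc.IH[of "(x + 1) div 3" j] by simp
  qed
qed simp

text \<open>The lowest nonzero digit is cancelled by adding its negative at that position, which
  produces no carry.\<close>

lemma balanced_weight_Suc_reduce:
  assumes "balanced_weight h x = Suc n"
  obtains s i where "s = 1 \<or> s = -1" "i < h" "balanced_weight h (x + s * 3 ^ i) = n"
  using assms
proof (induction h arbitrary: x n thesis)
  case (Suc h)
  show thesis
  proof (cases "3 dvd x")
    case False
    then have "x mod 3 = 1 \<or> x mod 3 = 2"
      by presburger
    \<comment> \<open>\<open>s\<close> is the negative of the last digit: residue 1 is the digit 1,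
      residue 2 the digit -1.\<close>
    then obtain s :: int where s: "s = 1 \<or> s = -1" "3 dvd x + s" "(x + s + 1) div 3 = (x + 1) div 3"
    proof
      assume "x mod 3 = 1"
      then show thesis by (intro that[of "-1"]; presburger)
    next
      assume "x mod 3 = 2"
      then show thesis by (intro that[of 1]; presburger)
    qed
    have "balanced_weight (Suc h) (x + s * 3 ^ 0) = n"
      using s False Suc.prems(2) by simp
    then show thesis
      using Suc.prems(1) s(1) by blast
  next
    case True
    then have "balanced_weight h ((x + 1) div 3) = Suc n"
      using Suc.prems(2) by simp
    then obtain s i where si: "s = 1 \<or> s = -1" "i < h"
        "balanced_weight h ((x + 1) div 3 + s * 3 ^ i) = n"
      using Suc.IH by blast
    have "(x + s * 3 ^ Suc i + 1) div 3 = (x + 1) div 3 + s * 3 ^ i"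
      by (simp add: algebra_simps)
    then have "balanced_weight (Suc h) (x + s * 3 ^ Suc i) = n"
      using True si(3) by (simp add: dvd_add_left_iff)
    then show thesis
      using Suc.prems(1) si(1,2) Suc_less_eq by blast
  qed
qed simp

section \<open>Total weight over a complete residue system\<close>

text \<open>Moving the window by one trades the value at \<open>b\<close> for the equal value at
  \<open>b + int n\<close>; integer induction runs in both directions.\<close>

lemma sum_periodic_shift:
  fixes f :: "int \<Rightarrow> 'a :: ab_group_add" and n :: nat
  assumes periodic: "\<And>x. f (x + int n) = f x"
  shows "sum f {a..<a + int n} = sum f {0..<int n}"
proof (cases "n = 0")
  case False
  have step: "sum f {b + 1..<b + 1 + int n} = sum f {b..<b + int n}" for b
  proof -
    have "{b + 1..<b + 1 + int n} = insert (b + int n) ({b..<b + int n} - {b})"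
      using False by auto
    then show ?thesis
      using False by (simp add: periodic sum_diff1)
  qed
  show ?thesis
  proof (induction a rule: int_induct[where k = 0])
    case (step1 i)
    then show ?case using step[of i] by simp
  next
    case (step2 i)
    then show ?case using step[of "i - 1"] by simp
  qed simp
qed simp

text \<open>Starting at -1 centres the triples at \<open>3 * q\<close>, so that
  \<open>(x + 1) div 3\<close> is constantly \<open>q\<close> on each.\<close>

lemma sum_group_by_three:
  fixes f :: "int \<Rightarrow> 'a :: comm_monoid_add"
  shows "sum f {-1..<3 * int n - 1} = (\<Sum>q\<in>{0..<int n}. f (3 * q - 1) + f (3 * q) + f (3 * q + 1))"
proof (induction n)
  case (Suc n)
  have "{-1..<3 * int (Suc n) - 1} =
      insert (3 * int n + 1) (insert (3 * int n) (insert (3 * int n - 1) {-1..<3 * int n - 1}))"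
    by auto
  moreover have "{0..<int (Suc n)} = insert (int n) {0..<int n}"
    by auto
  ultimately show ?case
    using Suc.IH by (simp add: ac_simps)
qed simp

text \<open>Each triple with quotient \<open>q\<close> has two nonzero last digits and contributes
  the weight of \<open>q\<close> three times. Dividing by 3 keeps truncated subtraction out of the
  induction.\<close>

lemma sum_balanced_weight:
  "(\<Sum>x\<in>{a..<a + 3 ^ h}. real (balanced_weight h x)) = 2 * real h * 3 ^ h / 3"
proof (induction h arbitrary: a)
  case (Suc h)
  let ?f = "\<lambda>x. real (balanced_weight (Suc h) x)"
  have periodic: "?f (x + int (3 ^ Suc h)) = ?f x" for x
    using balanced_weight_add_period[of "Suc h" x 1] by simp
  have "sum ?f {a..<a + 3 ^ Suc h} = sum ?f {0..<3 ^ Suc h}" for a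
    using sum_periodic_shift[of ?f "3 ^ Suc h" a, OF periodic] by simp
  then have "sum ?f {a..<a + 3 ^ Suc h} = sum ?f {-1..<-1 + 3 ^ Suc h}"
    by metis
  also have "\<dots> = sum ?f {-1..<3 * int (3 ^ h) - 1}"
    by (simp add: algebra_simps)
  also have "\<dots> = (\<Sum>q\<in>{0..<int (3 ^ h)}. ?f (3 * q - 1) + ?f (3 * q) + ?f (3 * q + 1))"
    by (rule sum_group_by_three)
  also have "\<dots> = (\<Sum>q\<in>{0..<int (3 ^ h)}. 2 + 3 * real (balanced_weight h q))"
  proof (rule sum.cong[OF refl])
    fix q :: int
    have "\<not> 3 dvd 3 * q - 1" "3 dvd 3 * q" "\<not> 3 dvd 3 * q + 1"
      "(3 * q - 1 + 1) div 3 = q" "(3 * q + 1) div 3 = q" "(3 * q + 1 + 1) div 3 = q"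
      by presburger+
    then show "?f (3 * q - 1) + ?f (3 * q) + ?f (3 * q + 1) = 2 + 3 * real (balanced_weight h q)"
      by (simp only: balanced_weight.simps) simp
  qed
  also have "\<dots> = 2 * real (Suc h) * 3 ^ Suc h / 3"
    using Suc.IH[of 0] by (simp add: sum.distrib algebra_simps flip: sum_distrib_left)
  finally show ?case .
qed simp

section \<open>Nonnegative matrices with constant row sums\<close>

text \<open>The all-ones vector has eigenvalue \<open>r\<close>. Any real eigenvalue is bounded by
  \<open>r\<close> by comparing both sides of the eigenvector equation at an entry of largest
  absolute value.\<close>

lemma Max_spectrum_const_row_sum:
  fixes A :: "real mat"
  assumes A: "A \<in> carrier_mat n n" and "n > 0"
    and nonneg: "\<And>i j. i < n \<Longrightarrow> j < n \<Longrightarrow> A $$ (i, j) \<ge> 0"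
    and row_sum: "\<And>i. i < n \<Longrightarrow> (\<Sum>j<n. A $$ (i, j)) = r"
  shows "Max (spectrum A) = r"
proof (rule Max_eqI)
  show "finite (spectrum A)"
    using card_finite_spectrum[OF A] by simp
next
  have "eigenvector A (vec n (\<lambda>_. 1)) r"
    unfolding eigenvector_def
  proof (intro conjI)
    show "vec n (\<lambda>_. 1) \<noteq> (0\<^sub>v (dim_row A) :: real vec)"
      using A \<open>n > 0\<close> by (auto simp: vec_eq_iff)
    show "A *\<^sub>v vec n (\<lambda>_. 1) = r \<cdot>\<^sub>v vec n (\<lambda>_. 1)"
      using A row_sum by (auto simp: scalar_prod_def lessThan_atLeast0)
  qed (use A in auto)
  then show "r \<in> spectrum A"
    by (auto simp: spectrum_def eigenvalue_def)
next
  fix k assume "k \<in> spectrum A"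
  then obtain v where v: "v \<in> carrier_vec n" "v \<noteq> 0\<^sub>v n" and ev: "A *\<^sub>v v = k \<cdot>\<^sub>v v"
    using A by (auto simp: spectrum_def eigenvalue_def eigenvector_def)
  define M where "M = Max ((\<lambda>i. \<bar>v $ i\<bar>) ` {..<n})"
  have M_ge: "\<bar>v $ i\<bar> \<le> M" if "i < n" for i
    using that by (auto simp: M_def)
  have "M \<in> (\<lambda>i. \<bar>v $ i\<bar>) ` {..<n}"
    unfolding M_def using \<open>n > 0\<close> by (intro Max_in) auto
  then obtain i where i: "i < n" "M = \<bar>v $ i\<bar>"
    by auto
  obtain l where "l < n" "v $ l \<noteq> 0"
    using v by (auto simp: vec_eq_iff)
  then have "M > 0"
    using M_ge[of l] by linarith
  have "k * v $ i = (A *\<^sub>v v) $ i"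
    using ev i v by simp
  also have "\<dots> = (\<Sum>j<n. A $$ (i, j) * v $ j)"
    using A v i by (auto simp: scalar_prod_def lessThan_atLeast0)
  finally have "\<bar>k\<bar> * M = \<bar>\<Sum>j<n. A $$ (i, j) * v $ j\<bar>"
    using i by (metis abs_mult)
  also have "\<dots> \<le> (\<Sum>j<n. \<bar>A $$ (i, j) * v $ j\<bar>)"
    by (rule sum_abs)
  also have "\<dots> \<le> (\<Sum>j<n. A $$ (i, j) * M)"
    using nonneg i(1) M_ge by (intro sum_mono) (auto simp: abs_mult intro!: mult_left_mono)
  also have "\<dots> = r * M"
    using row_sum[OF i(1)] by (simp flip: sum_distrib_right)
  finally show "k \<le> r"
    using \<open>M > 0\<close> by simp
qed

section \<open>Distances in the multiplicative circulant graph\<close>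

text \<open>\<open>\<mu>\<close> is an infimum of walk costs; a walk attaining it makes it finite,
  so the conversion to \<open>real\<close> loses nothing.\<close>

lemma graph_dist_eqI:
  assumes "pair_wf_digraph G"
    and walk: "pre_digraph.awalk (with_proj G) u p v" "length p = n"
    and shortest: "\<And>q. pre_digraph.awalk (with_proj G) u q v \<Longrightarrow> n \<le> length q"
  shows "graph_dist G u v = real n"
proof -
  interpret wf_digraph "with_proj G"
    using assms(1) by (simp add: wf_digraph_wp_iff)
  have cost: "awalk_cost (\<lambda>_. 1) q = real (length q)" for q :: "('a \<times> 'a) list"
    by (induction q) simp_all
  have "\<mu> (\<lambda>_. 1) u v = ereal (real n)"
    unfolding \<mu>_def cost
  proof (rule INF_eqI)
    show "ereal (real n) \<le> ereal (real (length q))" if "q \<in> {p. awalk u p v}" for q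
      using shortest that by simp
    show "y \<le> ereal (real n)" if "\<And>q. q \<in> {p. awalk u p v} \<Longrightarrow> y \<le> ereal (real (length q))" for y
      using walk that by blast
  qed
  then show ?thesis
    by (simp add: graph_dist_def)
qed

lemma pair_wf_digraph_MC: "pair_wf_digraph (MC m h)"
  by unfold_locales (auto simp: MC_def)

text \<open>Each arc changes the difference to \<open>v\<close> by a signed power of 3, so the
  weight falls by at most one per step and is 0 at the end.\<close>

lemma balanced_weight_le_walk_length:
  assumes "pre_digraph.awalk (with_proj (MC 3 h)) u p v"
  shows "balanced_weight h (v - u) \<le> length p"
proof -
  interpret pair_wf_digraph "MC 3 h"
    by (rule pair_wf_digraph_MC)
  show ?thesis
    using assms
  proof (induction p arbitrary: u)
    case Nil
    then show ?case by (simp add: awalk_Nil_iff)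
  next
    case (Cons e p)
    then obtain w where e: "(u, w) \<in> parcs (MC 3 h)" and "awalk w p v"
      by (cases e) (auto simp: awalk_Cons_iff)
    then have IH: "balanced_weight h (v - w) \<le> length p"
      using Cons.IH by blast
    \<comment> \<open>The sign is chosen so that \<open>v - u\<close> is congruent to
      \<open>v - w + s * 3 ^ i\<close>.\<close>
    obtain s :: int and i where s: "s = 1 \<or> s = -1" and "[u - w = - s * 3 ^ i] (mod 3 ^ h)"
      using e by (force simp: MC_def)
    then have "[v - w - (u - w) = v - w - (- s * 3 ^ i)] (mod 3 ^ h)"
      by (intro cong_diff cong_refl)
    then have "balanced_weight h (v - u) = balanced_weight h (v - w + s * 3 ^ i)"
      using balanced_weight_cong by simp
    also have "\<dots> \<le> Suc (balanced_weight h (v - w))"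
      by (rule balanced_weight_add_power_le[OF s])
    finally show ?case
      using IH by simp
  qed
qed

text \<open>A greedy walk cancels one nonzero digit of the remaining difference per step.\<close>

lemma walk_of_balanced_weight:
  assumes "u \<in> {0..<3 ^ h}" "v \<in> {0..<3 ^ h}"
  shows "\<exists>p. pre_digraph.awalk (with_proj (MC 3 h)) u p v \<and> length p = balanced_weight h (v - u)"
proof -
  interpret pair_wf_digraph "MC 3 h"
    by (rule pair_wf_digraph_MC)
  show ?thesis
    using assms
  proof (induction "balanced_weight h (v - u)" arbitrary: u)
    case 0
    then have "[v = u] (mod 3 ^ h)"
      using balanced_weight_eq_0D[of h "v - u"] by (simp add: cong_iff_dvd_diff)
    then have "u = v"
      using 0 by (simp add: cong_def)
    moreover have "u \<in> pverts (MC 3 h)"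
      using 0 by (simp add: MC_def)
    ultimately have "awalk u [] v"
      by (simp add: awalk_Nil_iff)
    then show ?case
      using 0 by force
  next
    case (Suc n)
    obtain s i where s: "s = 1 \<or> s = -1" and "i < h"
        and n: "balanced_weight h (v - u + s * 3 ^ i) = n"
      using balanced_weight_Suc_reduce[OF Suc(2)[symmetric]] by metis
    \<comment> \<open>Reduction modulo \<open>3 ^ h\<close> brings the next point back into the
      vertex set.\<close>
    define w where "w = (u - s * 3 ^ i) mod 3 ^ h"
    have w: "w \<in> {0..<3 ^ h}"
      by (simp add: w_def)
    have w_cong: "[w = u - s * 3 ^ i] (mod 3 ^ h)"
      by (simp add: w_def)
    have "[v - w = v - (u - s * 3 ^ i)] (mod 3 ^ h)"
      using w_cong by (intro cong_diff cong_refl)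
    then have "balanced_weight h (v - w) = n"
      using n balanced_weight_cong by (simp add: algebra_simps)
    then obtain p where p: "awalk w p v" "length p = n"
      using Suc(1)[of w] w Suc.prems(2) by auto
    \<comment> \<open>Adjacency requires distinct ends; equality would force
      \<open>n = Suc n\<close>.\<close>
    have "w \<noteq> u"
      using \<open>balanced_weight h (v - w) = n\<close> Suc(2) by auto
    moreover have "[u - w = u - (u - s * 3 ^ i)] (mod 3 ^ h)"
      using w_cong by (intro cong_diff cong_refl)
    ultimately have "(u, w) \<in> parcs (MC 3 h)"
      using s \<open>i < h\<close> w Suc.prems(1) by (auto simp: MC_def)
    then have "awalk u ((u, w) # p) v"
      using p by (simp add: awalk_Cons_iff)
    then show ?case
      using p Suc(2) by (metis length_Cons)
  qed
qed

lemma graph_dist_MC: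
  assumes "u \<in> {0..<3 ^ h}" "v \<in> {0..<3 ^ h}"
  shows "graph_dist (MC 3 h) u v = real (balanced_weight h (v - u))"
  using walk_of_balanced_weight[OF assms] balanced_weight_le_walk_length
  by (blast intro: graph_dist_eqI[OF pair_wf_digraph_MC])

section \<open>The distance matrix and its spectral radius\<close>

text \<open>This identifies matrix index \<open>i\<close> with the vertex
  \<open>int i\<close>.\<close>

lemma sorted_list_of_set_int_interval:
  "sorted_list_of_set {0..<int n} = map int [0..<n]"
proof -
  have "set (map int [0..<n]) = {0..<int n}"
    by (simp add: image_int_atLeastLessThan)
  moreover have "sorted (map int [0..<n])" "distinct (map int [0..<n])"
    by (auto simp: sorted_map distinct_map sorted_wrt_iff_nth_less)
  ultimately show ?thesis
    by (metis sorted_list_of_set.idem_if_sorted_distinct)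
qed

lemma distance_matrix_MC:
  "distance_matrix (MC 3 h) =
    mat (3 ^ h) (3 ^ h) (\<lambda>(i, j). real (balanced_weight h (int j - int i)))"
proof -
  have verts: "pverts (MC 3 h) = {0..<int (3 ^ h)}"
    by (simp add: MC_def)
  have entry: "graph_dist (MC 3 h) (int i) (int j) = real (balanced_weight h (int j - int i))"
    if "i < 3 ^ h" "j < 3 ^ h" for i j
    using that by (intro graph_dist_MC) (auto simp flip: of_nat_less_iff)
  have card: "card {0..<int (3 ^ h)} = 3 ^ h"
    by (simp only: card_atLeastLessThan_int diff_zero nat_int)
  show ?thesis
    unfolding distance_matrix_def Let_def verts card sorted_list_of_set_int_interval
    by (rule eq_matI) (simp_all add: entry)
qed

theorem theorem3p23:
  fixes h :: nat
  assumes "h > 0"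
  shows "distance_spectral_radius (MC 3 h) = 2 * real h * 3 ^ (h - 1)"
  unfolding distance_spectral_radius_def
proof (rule Max_spectrum_const_row_sum[where n = "3 ^ h"])
  fix i assume "i < (3::nat) ^ h"
  have "(\<Sum>j<3 ^ h. distance_matrix (MC 3 h) $$ (i, j)) =
      (\<Sum>j<3 ^ h. real (balanced_weight h (int j - int i)))"
    using \<open>i < 3 ^ h\<close> by (simp add: distance_matrix_MC)
  \<comment> \<open>Substituting \<open>x = int j - int i\<close> turns row \<open>i\<close> into a
    window of \<open>3 ^ h\<close> consecutive integers, whose total weight does not depend on
    \<open>i\<close>.\<close>
  also have "\<dots> = (\<Sum>x\<in>{- int i..<- int i + 3 ^ h}. real (balanced_weight h x))"
    by (rule sum.reindex_bij_witness[where i = "\<lambda>x. nat (x + int i)" and j = "\<lambda>j. int j - int i"])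
      (auto simp: nat_less_iff simp flip: of_nat_less_iff)
  also have "\<dots> = 2 * real h * 3 ^ h / 3"
    by (rule sum_balanced_weight)
  also have "\<dots> = 2 * real h * 3 ^ (h - 1)"
    using assms by (cases h) simp_all
  finally show "(\<Sum>j<3 ^ h. distance_matrix (MC 3 h) $$ (i, j)) = 2 * real h * 3 ^ (h - 1)" .
qed (simp_all add: distance_matrix_MC)

end
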